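(* Let $n$ be a positive integer and let $k,l$ be integers with $1\le k$, $k+4\le l\le n$. Any $n\times n$ strictly upper triangular matrix of an $L_2(k,l)$-formation is CN-realizable.
   Context: $L_2(k,l)$-formation. A strictly upper triangular $n\times n$ matrix $M$ has an $L_2(k,l)$-formation if: - $M(k,j)=2$ when $j=k+1$, $j=k+2$ or $k+4\le j\le l$; - $M(k,k+3)$ is $0$ or $2$; - $M(k+2,k+4)$ is $0$ or $2$; - $M(k+3,j)=2$ when $k+4\le j\le l$; - all other entries are $0$. Braid projections. An $n$-braid projection $B$ consists of $n$ strands in the plane, each running monotonically downward from one of $n$ points on an upper horizontal bar to one of $n$ points on a lower horizontal bar, meeting each other only in finitely many transverse double points (crossings), with no over/under information. The strands are named $s_1,\dots,s_n$ from left to right at the top. Combinatorially, $B$ is encoded by a finite word with letters in $\{1,\dots,n-1\}$: reading from top to bottom, the letter $k$ means that the two strands currently in positions $k$ and $k+1$ cross once and exchange positions (no reduction is assumed). The CN matrix $N(B)$ is the symmetric zero-diagonal $n\times n$ matrix whose $(i,j)$ entry ($i\neq j$) is the number of crossings between $s_i$ and $s_j$. CN matrices are represented by strictly upper triangular matrices: a strictly upper triangular $n\times n$ matrix $M$ is CN-realizable if there is an $n$-braid projection $B$ with $M(i,j)=N(B)(i,j)$ for all $1\le i<j\le n$. *)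

theory Defs
  imports "Jordan_Normal_Form.Matrix" "HOL-Combinatorics.Transposition"
begin

(* Rows, columns, positions and strands are numbered from 1, whereas the library numbers
   matrix entries from 0; entry is only ever used at indices in {1..n}. *)
definition entry :: "'a mat \<Rightarrow> nat \<Rightarrow> nat \<Rightarrow> 'a" where
  "entry M i j = M $$ (i - 1, j - 1)"

definition strictly_upper_triangular :: "'a::zero mat \<Rightarrow> bool" where
  "strictly_upper_triangular M \<longleftrightarrow>
     square_mat M \<and> (\<forall>i < dim_row M. \<forall>j \<le> i. M $$ (i, j) = 0)"

definition L2_formation :: "nat \<Rightarrow> nat \<Rightarrow> nat mat \<Rightarrow> bool" where
  "L2_formation k l M \<longleftrightarrow>
     (\<forall>j. j = k + 1 \<or> j = k + 2 \<or> (k + 4 \<le> j \<and> j \<le> l) \<longrightarrow> entry M k j = 2) \<and>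
     entry M k (k + 3) \<in> {0, 2} \<and>
     entry M (k + 2) (k + 4) \<in> {0, 2} \<and>
     (\<forall>j. k + 4 \<le> j \<and> j \<le> l \<longrightarrow> entry M (k + 3) j = 2) \<and>
     (\<forall>i \<in> {1..dim_row M}. \<forall>j \<in> {1..dim_col M}.
        \<not> (i = k \<and> (j = k + 1 \<or> j = k + 2 \<or> j = k + 3 \<or> (k + 4 \<le> j \<and> j \<le> l))) \<and>
        \<not> (i = k + 2 \<and> j = k + 4) \<and>
        \<not> (i = k + 3 \<and> k + 4 \<le> j \<and> j \<le> l) \<longrightarrow> entry M i j = 0)"

definition braid_projection :: "nat \<Rightarrow> nat list \<Rightarrow> bool" where
  "braid_projection n w \<longleftrightarrow> set w \<subseteq> {1..<n}"

(* strand_at w p: index of the strand in position p below the crossings listed in w *)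
definition strand_at :: "nat list \<Rightarrow> nat \<Rightarrow> nat" where
  "strand_at w = fold (\<lambda>k \<sigma>. \<sigma> \<circ> transpose k (k + 1)) w id"

(* the two strands that meet at the t-th crossing from the top, with t counted from 0 *)
definition crossing :: "nat list \<Rightarrow> nat \<Rightarrow> nat set" where
  "crossing w t = strand_at (take t w) ` {w ! t, w ! t + 1}"

definition crossings :: "nat list \<Rightarrow> nat \<Rightarrow> nat \<Rightarrow> nat" where
  "crossings w i j = card {t. t < length w \<and> crossing w t = {i, j}}"

definition CN_matrix :: "nat \<Rightarrow> nat list \<Rightarrow> nat mat" where
  "CN_matrix n w = mat n n (\<lambda>(i, j). if i = j then 0 else crossings w (i + 1) (j + 1))"

definition CN_realizable :: "nat \<Rightarrow> nat mat \<Rightarrow> bool" where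
  "CN_realizable n M \<longleftrightarrow>
     M \<in> carrier_mat n n \<and> strictly_upper_triangular M \<and>
     (\<exists>w. braid_projection n w \<and>
        (\<forall>i j. 1 \<le> i \<and> i < j \<and> j \<le> n \<longrightarrow> entry M i j = entry (CN_matrix n w) i j))"

end

theory Submission
  imports Defs
begin

text \<open>
  A strand that sweeps across a block of neighbours and returns along the same path crosses each
  of them twice, and any pure word performed in between is merely relabelled. If
  \<open>M(k,k+3) = 2\<close>, let \<open>s\<^sub>k\<close> sweep over everything up to \<open>s\<^sub>l\<close> and
  return; then let \<open>s\<^sub>k\<^sub>+\<^sub>3\<close> do the same, twisting \<open>s\<^sub>k\<^sub>+\<^sub>2\<close> with
  \<open>s\<^sub>k\<^sub>+\<^sub>4\<close>, if required, while \<open>s\<^sub>k\<^sub>+\<^sub>3\<close> is out of the way. If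
  \<open>M(k,k+3) = 0\<close>, the sweep of \<open>s\<^sub>k\<close> is also performed while
  \<open>s\<^sub>k\<^sub>+\<^sub>3\<close> is parked at position \<open>l\<close>, and stops just before it.
\<close>

lemma strand_at_Nil [simp]: "strand_at [] = id"
  by (simp add: strand_at_def)

lemma strand_at_snoc: "strand_at (w @ [a]) = strand_at w \<circ> transpose a (a + 1)"
  by (simp add: strand_at_def)

lemma strand_at_append: "strand_at (u @ v) = strand_at u \<circ> strand_at v"
proof (induction v rule: rev_induct)
  case (snoc a v)
  then show ?case
    using strand_at_snoc[of "u @ v" a] by (simp add: strand_at_snoc o_assoc)
qed simp

lemma strand_at_single: "strand_at [a] = transpose a (a + 1)"
  by (simp add: strand_at_def)

lemma crossings_Nil [simp]: "crossings [] i j = 0"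
  by (simp add: crossings_def)

lemma crossings_snoc:
  "crossings (w @ [a]) i j = crossings w i j + of_bool (strand_at w ` {a, a + 1} = {i, j})"
proof -
  let ?S = "{t. t < length w \<and> crossing w t = {i, j}}"
  have 1: "crossing (w @ [a]) t = crossing w t" if "t < length w" for t
    using that by (simp add: crossing_def nth_append)
  have 2: "crossing (w @ [a]) (length w) = strand_at w ` {a, a + 1}"
    by (simp add: crossing_def)
  have "{t. t < length (w @ [a]) \<and> crossing (w @ [a]) t = {i, j}}
      = (if strand_at w ` {a, a + 1} = {i, j} then insert (length w) ?S else ?S)"
    using 1 2 by (auto simp: less_Suc_eq)
  then show ?thesis
    by (simp add: crossings_def)
qed

text \<open>Within \<open>v\<close>, strands are named by their positions just below
  \<open>u\<close>. The inverse \<open>\<pi>\<close> of \<open>strand_at u\<close> sends each strand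
  to that position.\<close>

lemma crossings_append:
  assumes "\<And>x. \<pi> (strand_at u x) = x" "\<And>x. strand_at u (\<pi> x) = x"
  shows "crossings (u @ v) i j = crossings u i j + crossings v (\<pi> i) (\<pi> j)"
proof (induction v rule: rev_induct)
  case (snoc a v)
  have inv: "strand_at u x = y \<longleftrightarrow> x = \<pi> y" for x y
    using assms by metis
  have "strand_at (u @ v) ` {a, a + 1} = {i, j} \<longleftrightarrow>
      strand_at v ` {a, a + 1} = {\<pi> i, \<pi> j}"
    by (simp add: strand_at_append doubleton_eq_iff inv)
  then show ?case
    using snoc crossings_snoc[of "u @ v" a] by (simp add: crossings_snoc)
qed simp

lemma crossings_append_pure:
  assumes "strand_at u = id"
  shows "crossings (u @ v) i j = crossings u i j + crossings v i j"
  using crossings_append[of id u v] assms by simp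

lemma strand_at_conj:
  assumes "strand_at v = id"
  shows "strand_at (a # v @ [a]) = id"
  using strand_at_append[of "[a]" "v @ [a]"] assms
  by (simp add: strand_at_append strand_at_single)

lemma crossings_conj:
  assumes "strand_at v = id"
  shows "crossings (a # v @ [a]) i j =
    2 * of_bool ({i, j} = {a, a + 1}) +
    crossings v (transpose a (a + 1) i) (transpose a (a + 1) j)"
proof -
  have "crossings ([a] @ v @ [a]) i j = crossings [a] i j +
      crossings (v @ [a]) (transpose a (a + 1) i) (transpose a (a + 1) j)"
    by (rule crossings_append) (simp_all add: strand_at_single)
  moreover have "crossings [a] i j = of_bool ({i, j} = {a, a + 1})"
    using crossings_snoc[of "[]" a i j] by (simp add: eq_commute)
  \<comment> \<open>As \<open>v\<close> is pure, the closing letter meets the same two strands as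
    the opening one: the transposition preserves the pair. Hence the factor 2.\<close>
  moreover have "{a, a + 1} = {transpose a (a + 1) i, transpose a (a + 1) j}
      \<longleftrightarrow> {i, j} = {a, a + 1}"
    by (auto simp: doubleton_eq_iff transpose_def split: if_splits)
  ultimately show ?thesis
    using assms by (simp add: crossings_snoc)
qed

definition sweep :: "nat \<Rightarrow> nat \<Rightarrow> nat list \<Rightarrow> nat list" where
  "sweep p q v = [p..<q] @ v @ rev [p..<q]"

text \<open>For \<open>p \<le> q\<close> this is the inverse of \<open>strand_at [p..<q]\<close>:
  the position of strand \<open>i\<close> while strand \<open>p\<close> is parked at
  \<open>q\<close>.\<close>

definition swept_position :: "nat \<Rightarrow> nat \<Rightarrow> nat \<Rightarrow> nat" where
  "swept_position p q i = (if i = p then q else if p < i \<and> i \<le> q then i - 1 else i)"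

lemma set_sweep: "set (sweep p q v) = {p..<q} \<union> set v"
  by (auto simp: sweep_def)

lemma sweep_same [simp]: "sweep p p v = v"
  by (simp add: sweep_def)

lemma sweep_rec: "p < q \<Longrightarrow> sweep p q v = p # sweep (Suc p) q v @ [p]"
  by (simp add: sweep_def upt_conv_Cons)

lemma strand_at_sweep:
  assumes "p \<le> q" "strand_at v = id"
  shows "strand_at (sweep p q v) = id"
  using assms(1)
proof (induction rule: inc_induct)
  case (step p)
  then show ?case by (simp only: sweep_rec strand_at_conj)
qed (simp add: assms(2))

text \<open>Induction downwards from \<open>p = q\<close> wraps one more pair of letters around the
  word at each step, and each pair adds one double crossing.\<close>

lemma crossings_sweep:
  assumes "p \<le> q" "strand_at v = id"
  shows "crossings (sweep p q v) i j =
    2 * of_bool (i = p \<and> p < j \<and> j \<le> q \<or> j = p \<and> p < i \<and> i \<le> q) +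
    crossings v (swept_position p q i) (swept_position p q j)"
  using assms(1)
proof (induction arbitrary: i j rule: inc_induct)
  case base
  then show ?case by (auto simp: swept_position_def)
next
  case (step p)
  let ?\<tau> = "transpose p (p + 1)"
  have pos: "swept_position (Suc p) q (?\<tau> x) = swept_position p q x" for x
    using step.hyps by (auto simp: swept_position_def transpose_def)
  have "strand_at (sweep (Suc p) q v) = id"
    using step.hyps assms(2) by (simp add: strand_at_sweep)
  then have "crossings (sweep p q v) i j =
      2 * of_bool ({i, j} = {p, p + 1}) + crossings (sweep (Suc p) q v) (?\<tau> i) (?\<tau> j)"
    using step.hyps by (simp only: sweep_rec crossings_conj)
  also have "\<dots> = 2 * of_bool (i = p \<and> p < j \<and> j \<le> q \<or> j = p \<and> p < i \<and> i \<le> q) +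
      crossings v (swept_position p q i) (swept_position p q j)"
    unfolding step.IH pos using step.hyps
    by (auto simp: transpose_def doubleton_eq_iff of_bool_def)
  finally show ?case .
qed

theorem proposition19:
  fixes n k l :: nat and M :: "nat mat"
  assumes "0 < n"
    and "1 \<le> k" and "k + 4 \<le> l" and "l \<le> n"
    and "M \<in> carrier_mat n n"
    and "strictly_upper_triangular M"
    and "L2_formation k l M"
  shows "CN_realizable n M"
proof -
  define x where "x = entry M k (k + 3)"
  define y where "y = entry M (k + 2) (k + 4)"
  have xy: "x \<in> {0, 2}" "y \<in> {0, 2}"
    and row_k: "j = k + 1 \<or> j = k + 2 \<or> (k + 4 \<le> j \<and> j \<le> l) \<Longrightarrow> entry M k j = 2"
    and row_k3: "k + 4 \<le> j \<and> j \<le> l \<Longrightarrow> entry M (k + 3) j = 2"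
    and others: "\<lbrakk>i \<in> {1..n}; j \<in> {1..n};
      \<not> (i = k \<and> (j = k + 1 \<or> j = k + 2 \<or> j = k + 3 \<or> (k + 4 \<le> j \<and> j \<le> l)));
      \<not> (i = k + 2 \<and> j = k + 4); \<not> (i = k + 3 \<and> k + 4 \<le> j \<and> j \<le> l)\<rbrakk>
      \<Longrightarrow> entry M i j = 0" for i j
    using assms(5,7) unfolding L2_formation_def x_def y_def by auto
  \<comment> \<open>The second test also covers \<open>j = k + 3\<close>, so this entry is split off
    first.\<close>
  have entry_M: "entry M i j = (
      if i = k \<and> j = k + 3 then x
      else if i = k \<and> k < j \<and> j \<le> l then 2
      else if i = k + 2 \<and> j = k + 4 then y
      else if i = k + 3 \<and> k + 3 < j \<and> j \<le> l then 2 else 0)"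
    if "1 \<le> i" "i < j" "j \<le> n" for i j
  proof (cases "i = k \<and> k < j \<and> j \<le> l")
    case True
    then have "j = k + 1 \<or> j = k + 2 \<or> j = k + 3 \<or> (k + 4 \<le> j \<and> j \<le> l)"
      by auto
    with True row_k[of j] show ?thesis
      by (auto simp: x_def)
  next
    case False
    with that others[of i j] row_k3[of j] assms(3) show ?thesis
      by (auto simp: y_def)
  qed
  \<comment> \<open>With strand \<open>k + 3\<close> parked at \<open>l\<close>, strand
    \<open>k + 4\<close> stands at position \<open>k + 3\<close>, next to strand
    \<open>k + 2\<close>. For \<open>y = 0\<close> the word is empty.\<close>
  define twist where "twist = sweep (k + 2) (if y = 2 then k + 3 else k + 2) []"
  have pure_twist: "strand_at twist = id"
    by (simp add: twist_def strand_at_sweep)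
  have crossings_twist: "crossings twist i j =
      (if y = 2 \<and> (i = k + 2 \<and> j = k + 3 \<or> j = k + 2 \<and> i = k + 3) then 2 else 0)" for i j
    by (auto simp: twist_def crossings_sweep)
  \<comment> \<open>In the second word strand \<open>k + 3\<close> occupies position
    \<open>l\<close>, so a sweep from \<open>k\<close> to \<open>l - 1\<close> meets exactly the
    other strands among \<open>k + 1\<close> to \<open>l\<close>.\<close>
  define w where "w = (
    if x = 2 then sweep k l [] @ sweep (k + 3) l twist
    else sweep (k + 3) l (twist @ sweep k (l - 1) []))"
  have "braid_projection n w"
    using assms(2,3,4) by (auto simp: braid_projection_def w_def twist_def set_sweep)
  moreover have "entry M i j = crossings w i j" if ij: "1 \<le> i" "i < j" "j \<le> n" for i j
  proof (cases "x = 2")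
    case True
    have "crossings w i j = crossings (sweep k l []) i j + crossings (sweep (k + 3) l twist) i j"
      using True assms(3) by (simp add: w_def crossings_append_pure strand_at_sweep)
    then show ?thesis
      unfolding entry_M[OF ij] using True xy assms(3) ij
      by (auto simp: crossings_sweep pure_twist crossings_twist swept_position_def)
  next
    case False
    have "strand_at (twist @ sweep k (l - 1) []) = id"
      using assms(3) by (simp add: strand_at_append pure_twist strand_at_sweep)
    then show ?thesis
      unfolding entry_M[OF ij] using False xy assms(3) ij
      by (auto simp: w_def crossings_sweep pure_twist crossings_twist crossings_append_pure
        swept_position_def)
  qed
  ultimately show ?thesis
    using assms(5,6) by (auto simp: CN_realizable_def CN_matrix_def entry_def)
qed

end
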